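(* Let $(X,d)$ be a metric space and let $\mathcal{B}$ be a bornology on $X$ with a closed base. The map $\|F\|_{op}=\sup\{|F(f)|: f\in C(X),\ \|f\|_\infty\le 1\}$ defines a norm on $(C(X),\tau_{\mathcal{B}})^*$ if and only if $\mathcal{B}\subseteq\mathcal{K}$.
   Context: $C(X)$ is the real vector space of continuous functions $X\to\mathbb{R}$, and $\|f\|_\infty=\sup_{x\in X}|f(x)|$. A bornology $\mathcal{B}$ on $X$ is a collection of non-empty subsets of $X$ that covers $X$ and is closed under finite unions and under taking (non-empty) subsets of its members; it has a closed base if every member of $\mathcal{B}$ is contained in a closed member of $\mathcal{B}$. $\mathcal{K}$ is the bornology of all non-empty relatively compact subsets of $X$. For $B\in\mathcal{B}$ let $\rho_B(f)=\sup_{x\in B}|f(x)|\in[0,\infty]$. $\tau_{\mathcal{B}}$ is the translation-invariant topology on $C(X)$ for which the sets $\rho_B^{-1}([0,r))$ ($B\in\mathcal{B}$, $r>0$) form a neighborhood base at $0$. $(C(X),\tau_{\mathcal{B}})^*$ is the space of all continuous linear functionals $C(X)\to\mathbb{R}$. *)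

theory Defs
  imports "HOL-Analysis.Analysis"
begin

typedef (overloaded) 'a contfun = "{f :: 'a::topological_space \<Rightarrow> real. continuous_on UNIV f}"
  morphisms apply_contfun Contfun
  by (rule exI[of _ "\<lambda>_. 0"]) simp

setup_lifting type_definition_contfun

instantiation contfun :: (topological_space) real_vector
begin

lift_definition zero_contfun :: "'a contfun" is "\<lambda>_. 0" by simp

lift_definition plus_contfun :: "'a contfun \<Rightarrow> 'a contfun \<Rightarrow> 'a contfun"
  is "\<lambda>f g x. f x + g x" by (rule continuous_on_add)

lift_definition minus_contfun :: "'a contfun \<Rightarrow> 'a contfun \<Rightarrow> 'a contfun"
  is "\<lambda>f g x. f x - g x" by (rule continuous_on_diff)

lift_definition uminus_contfun :: "'a contfun \<Rightarrow> 'a contfun"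
  is "\<lambda>f x. - f x" by (rule continuous_on_minus)

lift_definition scaleR_contfun :: "real \<Rightarrow> 'a contfun \<Rightarrow> 'a contfun"
  is "\<lambda>c f x. c * f x" by (rule continuous_on_mult_left)

instance
  by standard (transfer; simp add: fun_eq_iff algebra_simps)+

end

definition bornology :: "'a set set \<Rightarrow> bool" where
  "bornology \<B> \<longleftrightarrow>
     {} \<notin> \<B> \<and>
     \<Union>\<B> = UNIV \<and>
     (\<forall>A\<in>\<B>. \<forall>B\<in>\<B>. A \<union> B \<in> \<B>) \<and>
     (\<forall>B\<in>\<B>. \<forall>A. A \<noteq> {} \<and> A \<subseteq> B \<longrightarrow> A \<in> \<B>)"

definition has_closed_base :: "'a::topological_space set set \<Rightarrow> bool" where
  "has_closed_base \<B> \<longleftrightarrow> (\<forall>B\<in>\<B>. \<exists>C\<in>\<B>. closed C \<and> B \<subseteq> C)"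

definition relatively_compact_sets :: "'a::topological_space set set" where
  "relatively_compact_sets = {A. A \<noteq> {} \<and> compact (closure A)}"

definition sup_on :: "'a::topological_space set \<Rightarrow> 'a contfun \<Rightarrow> ennreal" where
  "sup_on B f = (SUP x\<in>B. ennreal \<bar>apply_contfun f x\<bar>)"

abbreviation sup_norm :: "'a::topological_space contfun \<Rightarrow> ennreal" where
  "sup_norm \<equiv> sup_on UNIV"

text \<open>Since \<open>sup_on\<close> may take the value \<open>\<infinity>\<close>, this need not be a vector space topology. It is the
  translation-invariant topology with the sets \<open>{h. sup_on B h < r}\<close> as a neighbourhood base at 0;
  for a bornology these sets are open by \<open>openin_sup_on_less\<close> below.\<close>

definition bornology_topology :: "'a::topological_space set set \<Rightarrow> 'a contfun topology" where
  "bornology_topology \<B> = topology (\<lambda>U. \<forall>f\<in>U. \<exists>B\<in>\<B>. \<exists>r>0. \<forall>h. sup_on B h < ennreal r \<longrightarrow> f + h \<in> U)"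

lemma sup_on_Un: "sup_on (A \<union> B) f = sup (sup_on A f) (sup_on B f)"
  unfolding sup_on_def by (rule SUP_union)

lemma openin_bornology_topology:
  assumes "bornology \<B>"
  shows "openin (bornology_topology \<B>) U \<longleftrightarrow>
    (\<forall>f\<in>U. \<exists>B\<in>\<B>. \<exists>r>0. \<forall>h. sup_on B h < ennreal r \<longrightarrow> f + h \<in> U)"
proof -
  let ?P = "\<lambda>U. \<forall>f\<in>U. \<exists>B\<in>\<B>. \<exists>r>0. \<forall>h. sup_on B h < ennreal r \<longrightarrow> f + h \<in> U"
  have "istopology ?P"
    unfolding istopology_def
  proof (intro conjI allI impI)
    fix S T assume S: "?P S" and T: "?P T"
    show "?P (S \<inter> T)"
    proof
      fix f assume f: "f \<in> S \<inter> T"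
      obtain A r where A: "A \<in> \<B>" "r > 0" "\<forall>h. sup_on A h < ennreal r \<longrightarrow> f + h \<in> S"
        using S f by blast
      obtain B s where B: "B \<in> \<B>" "s > 0" "\<forall>h. sup_on B h < ennreal s \<longrightarrow> f + h \<in> T"
        using T f by blast
      have "A \<union> B \<in> \<B>" using assms A B by (auto simp: bornology_def)
      moreover have "min r s > 0" using A B by simp
      moreover have "f + h \<in> S \<inter> T" if h: "sup_on (A \<union> B) h < ennreal (min r s)" for h
      proof -
        have "ennreal (min r s) \<le> ennreal r" "ennreal (min r s) \<le> ennreal s"
          by (simp_all add: ennreal_leI)
        moreover have "sup_on A h \<le> sup_on (A \<union> B) h" "sup_on B h \<le> sup_on (A \<union> B) h"
          by (simp_all add: sup_on_Un)
        ultimately have "sup_on A h < ennreal r" "sup_on B h < ennreal s"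
          using h by order+
        then show ?thesis using A(3) B(3) by blast
      qed
      ultimately show "\<exists>B\<in>\<B>. \<exists>r>0. \<forall>h. sup_on B h < ennreal r \<longrightarrow> f + h \<in> S \<inter> T"
        by blast
    qed
  next
    fix \<K> assume "\<forall>K\<in>\<K>. ?P K"
    then show "?P (\<Union>\<K>)" by (meson Union_iff)
  qed
  then show ?thesis
    unfolding bornology_topology_def by (simp add: topology_inverse')
qed

lemma sup_on_add_le: "sup_on B (f + g) \<le> sup_on B f + sup_on B g"
  unfolding sup_on_def
proof (rule SUP_least)
  fix x assume x: "x \<in> B"
  have "ennreal \<bar>apply_contfun (f + g) x\<bar> \<le> ennreal \<bar>apply_contfun f x\<bar> + ennreal \<bar>apply_contfun g x\<bar>"
    by (simp add: plus_contfun.rep_eq flip: ennreal_plus)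
  also have "\<dots> \<le> (SUP x\<in>B. ennreal \<bar>apply_contfun f x\<bar>) + (SUP x\<in>B. ennreal \<bar>apply_contfun g x\<bar>)"
    using x by (intro add_mono SUP_upper)
  finally show "ennreal \<bar>apply_contfun (f + g) x\<bar> \<le> \<dots>" .
qed

lemma openin_sup_on_less:
  assumes "bornology \<B>" "B \<in> \<B>"
  shows "openin (bornology_topology \<B>) {f. sup_on B f < ennreal r}"
  unfolding openin_bornology_topology[OF assms(1)]
proof (intro ballI)
  fix f assume "f \<in> {f. sup_on B f < ennreal r}"
  then have f: "sup_on B f < ennreal r" by simp
  then obtain a where a: "sup_on B f = ennreal a" "0 \<le> a" by (cases "sup_on B f") auto
  have ar: "a < r" using f a by (simp add: ennreal_less_iff)
  have "sup_on B (f + h) < ennreal r" if h: "sup_on B h < ennreal (r - a)" for h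
  proof -
    have "sup_on B (f + h) \<le> ennreal a + sup_on B h" using sup_on_add_le a by metis
    also have "\<dots> < ennreal a + ennreal (r - a)" using h by (simp add: ennreal_add_left_cancel_less)
    also have "\<dots> = ennreal r" using a ar by (simp flip: ennreal_plus)
    finally show ?thesis .
  qed
  then show "\<exists>C\<in>\<B>. \<exists>s>0. \<forall>h. sup_on C h < ennreal s \<longrightarrow> f + h \<in> {f. sup_on B f < ennreal r}"
    using assms(2) ar by (intro bexI[of _ B] exI[of _ "r - a"]) auto
qed

definition bornology_dual :: "'a::topological_space set set \<Rightarrow> ('a contfun \<Rightarrow> real) set" where
  "bornology_dual \<B> = {F. linear F \<and> continuous_map (bornology_topology \<B>) euclideanreal F}"

definition op_norm :: "('a::topological_space contfun \<Rightarrow> real) \<Rightarrow> ennreal" where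
  "op_norm F = (SUP f\<in>{f. sup_norm f \<le> 1}. ennreal \<bar>F f\<bar>)"

text \<open>A \<open>[0,\<infinity>]\<close>-valued map defines a norm on a linear space \<open>V\<close> of real functionals (with pointwise
  operations) if it is finite on \<open>V\<close> and satisfies the norm axioms there.\<close>

definition defines_norm_on :: "('v \<Rightarrow> real) set \<Rightarrow> (('v \<Rightarrow> real) \<Rightarrow> ennreal) \<Rightarrow> bool" where
  "defines_norm_on V N \<longleftrightarrow>
     (\<forall>F\<in>V. N F < \<infinity>) \<and>
     (\<forall>F\<in>V. N F = 0 \<longleftrightarrow> F = (\<lambda>_. 0)) \<and>
     (\<forall>F\<in>V. \<forall>c::real. N (\<lambda>f. c * F f) = ennreal \<bar>c\<bar> * N F) \<and>
     (\<forall>F\<in>V. \<forall>G\<in>V. N (\<lambda>f. F f + G f) \<le> N F + N G)"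

end

theory Submission
  imports Defs
begin

text \<open>
  For every bornology, a continuous linear functional \<open>F\<close> satisfies \<open>\<bar>F h\<bar> < 1\<close> whenever
  \<open>sup_on B h < r\<close>, for some member \<open>B\<close> and some \<open>r > 0\<close>. On the sup-norm unit ball this bounds
  \<open>F\<close> by \<open>2 / r\<close>, so the operator norm is always a finite seminorm, and the only norm axiom at
  stake is definiteness: does a continuous \<open>F\<close> that vanishes on the bounded functions vanish
  identically?

  Suppose every member is relatively compact. The set \<open>B\<close> above supports \<open>F\<close>, because all multiples
  of a function vanishing on \<open>B\<close> lie in the region where \<open>\<bar>F\<bar> < 1\<close>
  (\<open>bornology_dual_vanishes\<close>). A continuous function agrees on \<open>B\<close> with one of its truncations, a
  bounded function (\<open>bounded_truncation\<close>), and so \<open>F\<close> is determined by its values on bounded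
  functions.

  Conversely, if some member is not relatively compact, then the closed base gives a closed
  noncompact member \<open>C\<close>, and some continuous \<open>f\<close> is unbounded on \<open>C\<close>
  (\<open>unbounded_on_closed_noncompact\<close>). The functions bounded on \<open>C\<close> form a linear subspace that is a
  neighbourhood of \<open>0\<close> and misses \<open>f\<close>. A linear functional that is zero on this subspace and
  nonzero at \<open>f\<close> is therefore continuous, and its operator norm is \<open>0\<close>.
\<close>

section \<open>The extended seminorms \<open>sup_on\<close>\<close>

lemma sup_on_scaleR: "sup_on B (c *\<^sub>R f) = ennreal \<bar>c\<bar> * sup_on B f"
  by (simp add: sup_on_def scaleR_contfun.rep_eq abs_mult ennreal_mult SUP_mult_left_ennreal)

lemma sup_on_le_iff: "sup_on B f \<le> u \<longleftrightarrow> (\<forall>x\<in>B. ennreal \<bar>apply_contfun f x\<bar> \<le> u)"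
  by (simp add: sup_on_def SUP_le_iff)

lemma sup_on_mono: "A \<subseteq> B \<Longrightarrow> sup_on A f \<le> sup_on B f"
  unfolding sup_on_def by (rule SUP_subset_mono) auto

lemma sup_on_zero: "sup_on B 0 = 0"
  using sup_on_scaleR[of B 0 0] by simp

lemma subspace_finite_sup_on: "subspace {f. sup_on B f < \<infinity>}"
proof (rule subspaceI)
  show "0 \<in> {f. sup_on B f < \<infinity>}" by (simp add: sup_on_zero)
next
  fix f g assume "f \<in> {f. sup_on B f < \<infinity>}" "g \<in> {f. sup_on B f < \<infinity>}"
  then have "sup_on B f + sup_on B g < \<infinity>" by simp
  then show "f + g \<in> {f. sup_on B f < \<infinity>}"
    using sup_on_add_le[of B f g] by (simp add: le_less_trans)
next
  fix c f assume "f \<in> {f. sup_on B f < \<infinity>}"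
  then show "c *\<^sub>R f \<in> {f. sup_on B f < \<infinity>}"
    by (simp add: sup_on_scaleR ennreal_mult_less_top)
qed

lemma bounded_truncation:
  assumes "compact (closure B)"
  obtains g where "sup_norm g < \<infinity>" "sup_on B (f - g) = 0"
proof -
  have cont: "continuous_on UNIV (apply_contfun f)"
    using apply_contfun[of f] by simp
  then have "compact (apply_contfun f ` closure B)"
    using assms compact_continuous_image continuous_on_subset by blast
  then obtain M where M: "\<And>x. x \<in> B \<Longrightarrow> \<bar>apply_contfun f x\<bar> \<le> M"
    using closure_subset[of B] by (force dest!: compact_imp_bounded simp: bounded_iff)
  \<comment> \<open>If \<open>B\<close> is empty, \<open>M\<close> may be negative; the absolute value keeps \<open>g\<close> a truncation.\<close>
  define g where "g = Contfun (\<lambda>x. max (-\<bar>M\<bar>) (min \<bar>M\<bar> (apply_contfun f x)))"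
  have g: "apply_contfun g x = max (-\<bar>M\<bar>) (min \<bar>M\<bar> (apply_contfun f x))" for x
    unfolding g_def using cont by (subst Contfun_inverse) (auto intro!: continuous_intros)
  have "sup_norm g \<le> ennreal \<bar>M\<bar>"
    by (auto simp: sup_on_le_iff g intro!: ennreal_leI)
  then have "sup_norm g < \<infinity>" by (simp add: le_less_trans)
  moreover have "apply_contfun g x = apply_contfun f x" if "x \<in> B" for x
    using M[OF that] by (simp add: g)
  then have "sup_on B (f - g) \<le> 0"
    by (subst sup_on_le_iff) (simp add: minus_contfun.rep_eq)
  ultimately show ?thesis using that by simp
qed

section \<open>Continuous functionals and the operator norm\<close>

lemma bornology_nonempty: "bornology \<B> \<Longrightarrow> \<exists>B. B \<in> \<B>"
  by (auto simp: bornology_def)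

lemma bornology_dual_bounded_near_0:
  assumes "bornology \<B>" "F \<in> bornology_dual \<B>"
  obtains B r where "B \<in> \<B>" "r > 0" "\<And>h. sup_on B h < ennreal r \<Longrightarrow> \<bar>F h\<bar> < 1"
proof -
  have lin: "linear F" and cont: "continuous_map (bornology_topology \<B>) euclideanreal F"
    using assms(2) by (auto simp: bornology_dual_def)
  have "openin (bornology_topology \<B>) UNIV"
    unfolding openin_bornology_topology[OF assms(1)]
    using bornology_nonempty[OF assms(1)] by (auto intro: exI[of _ 1])
  then have "topspace (bornology_topology \<B>) = UNIV"
    using openin_subset by blast
  moreover have "open {-1<..<1::real}" by simp
  ultimately have "openin (bornology_topology \<B>) {f. F f \<in> {-1<..<1}}"
    using openin_continuous_map_preimage[OF cont, of "{-1<..<1}"] by simp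
  moreover have "0 \<in> {f. F f \<in> {-1<..<1}}"
    using linear_0[OF lin] by simp
  ultimately obtain B r where "B \<in> \<B>" "r > 0"
      "\<forall>h. sup_on B h < ennreal r \<longrightarrow> 0 + h \<in> {f. F f \<in> {-1<..<1}}"
    unfolding openin_bornology_topology[OF assms(1)] by blast
  then show ?thesis using that[of B r] by (auto simp: abs_less_iff)
qed

text \<open>If \<open>h\<close> is zero on \<open>B\<close>, then so are all its multiples; \<open>F\<close> is therefore bounded by \<open>1\<close> on
  the whole line through \<open>h\<close>.\<close>

lemma bornology_dual_vanishes:
  fixes F :: "'a::topological_space contfun \<Rightarrow> real"
  assumes "linear F" and bound: "\<And>h. sup_on B h < ennreal r \<Longrightarrow> \<bar>F h\<bar> < 1"
    and "r > 0" and "sup_on B h = 0"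
  shows "F h = 0"
proof (rule ccontr)
  assume "F h \<noteq> 0"
  then have "F ((1 / F h) *\<^sub>R h) = 1"
    using linear_scale[OF assms(1)] by simp
  moreover have "sup_on B ((1 / F h) *\<^sub>R h) < ennreal r"
    using assms by (simp add: sup_on_scaleR)
  ultimately show False using bound by fastforce
qed

lemma op_norm_finite:
  assumes "bornology \<B>" "F \<in> bornology_dual \<B>"
  shows "op_norm F < \<infinity>"
proof -
  obtain B r where r: "r > 0" and bound: "\<And>h. sup_on B h < ennreal r \<Longrightarrow> \<bar>F h\<bar> < 1"
    using bornology_dual_bounded_near_0[OF assms] by metis
  have lin: "linear F" using assms(2) by (simp add: bornology_dual_def)
  have "\<bar>F f\<bar> \<le> 2 / r" if "sup_norm f \<le> 1" for f
  proof -
    \<comment> \<open>The neighbourhood is given by a strict inequality, so the unit ball is scaled to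
      radius \<open>r / 2\<close>.\<close>
    have "sup_on B ((r / 2) *\<^sub>R f) \<le> ennreal (r / 2) * 1"
      unfolding sup_on_scaleR using that sup_on_mono[of B UNIV f] r
      by (intro mult_mono) auto
    also have "\<dots> < ennreal r" using r by (simp add: ennreal_less_iff)
    finally have "\<bar>(r / 2) * F f\<bar> < 1"
      using bound linear_scale[OF lin, of "r / 2" f] by fastforce
    then show ?thesis using r by (simp add: abs_mult field_simps)
  qed
  then have "op_norm F \<le> ennreal (2 / r)"
    by (auto simp: op_norm_def SUP_le_iff intro!: ennreal_leI)
  then show ?thesis by (simp add: le_less_trans)
qed

lemma op_norm_mult: "op_norm (\<lambda>f. c * F f) = ennreal \<bar>c\<bar> * op_norm F"
  by (simp add: op_norm_def abs_mult ennreal_mult SUP_mult_left_ennreal)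

lemma op_norm_add_le: "op_norm (\<lambda>f. F f + G f) \<le> op_norm F + op_norm G"
proof -
  have "ennreal \<bar>F f + G f\<bar> \<le> op_norm F + op_norm G" if "sup_norm f \<le> 1" for f
  proof -
    have "ennreal \<bar>F f + G f\<bar> \<le> ennreal \<bar>F f\<bar> + ennreal \<bar>G f\<bar>"
      by (simp flip: ennreal_plus)
    also have "\<dots> \<le> op_norm F + op_norm G"
      unfolding op_norm_def using that by (intro add_mono SUP_upper) auto
    finally show ?thesis .
  qed
  then show ?thesis by (subst op_norm_def) (auto simp: SUP_le_iff)
qed

lemma op_norm_eq_0_iff:
  assumes "linear F"
  shows "op_norm F = 0 \<longleftrightarrow> (\<forall>f. sup_norm f < \<infinity> \<longrightarrow> F f = 0)"
proof
  assume 0: "op_norm F = 0"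
  show "\<forall>f. sup_norm f < \<infinity> \<longrightarrow> F f = 0"
  proof (intro allI impI)
    fix f :: "'a contfun" assume "sup_norm f < \<infinity>"
    then obtain a where a: "sup_norm f = ennreal a" "0 \<le> a"
      by (cases "sup_norm f") auto
    \<comment> \<open>The \<open>1 +\<close> keeps the scaling factor positive when \<open>f = 0\<close>.\<close>
    let ?c = "1 / (1 + a)"
    have "sup_norm (?c *\<^sub>R f) \<le> 1"
      using a by (simp add: sup_on_scaleR ennreal_le_1 flip: ennreal_mult)
    then have "ennreal \<bar>F (?c *\<^sub>R f)\<bar> \<le> op_norm F"
      unfolding op_norm_def by (intro SUP_upper) simp
    then have "F (?c *\<^sub>R f) = 0" using 0 by simp
    moreover have "?c \<noteq> 0" using a by simp
    ultimately show "F f = 0"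
      using linear_scale[OF assms, of ?c f] by simp
  qed
next
  assume *: "\<forall>f. sup_norm f < \<infinity> \<longrightarrow> F f = 0"
  have "F f = 0" if "sup_norm f \<le> 1" for f
    using * le_less_trans[OF that, of \<infinity>] by simp
  then have "op_norm F \<le> 0"
    unfolding op_norm_def by (intro SUP_least) simp
  then show "op_norm F = 0" by simp
qed

lemma op_norm_definite:
  assumes "bornology \<B>" "\<B> \<subseteq> relatively_compact_sets" "F \<in> bornology_dual \<B>" "op_norm F = 0"
  shows "F f = 0"
proof -
  have lin: "linear F" using assms(3) by (simp add: bornology_dual_def)
  obtain B r where B: "B \<in> \<B>" "r > 0" "\<And>h. sup_on B h < ennreal r \<Longrightarrow> \<bar>F h\<bar> < 1"
    using bornology_dual_bounded_near_0[OF assms(1,3)] by metis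
  have "compact (closure B)"
    using B(1) assms(2) by (auto simp: relatively_compact_sets_def)
  then obtain g where g: "sup_norm g < \<infinity>" "sup_on B (f - g) = 0"
    by (rule bounded_truncation)
  have "F (f - g) = 0"
    using bornology_dual_vanishes[OF lin B(3) B(2) g(2)] by simp
  moreover have "F g = 0"
    using op_norm_eq_0_iff[OF lin] assms(4) g(1) by simp
  ultimately show ?thesis using linear_diff[OF lin, of f g] by simp
qed

section \<open>A functional annihilating the bounded functions\<close>

text \<open>A closed noncompact set contains an infinite set without limit points. All subsets of the
  latter are closed, so any function on it is continuous and extends by Tietze's theorem; an
  enumeration of a countable part of it is unbounded.\<close>

lemma unbounded_on_closed_noncompact:
  fixes C :: "'a::metric_space set"
  assumes "closed C" "\<not> compact C"
  obtains f where "sup_on C f = \<infinity>"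
proof -
  obtain T where T: "infinite T" "T \<subseteq> C" "\<And>x. x \<in> C \<Longrightarrow> \<not> x islimpt T"
    using assms(2) unfolding compact_eq_Bolzano_Weierstrass by blast
  obtain e :: "nat \<Rightarrow> 'a" where e: "inj e" "range e \<subseteq> T"
    using infinite_countable_subset[OF T(1)] by blast
  have closed: "closed S" if "S \<subseteq> range e" for S
  proof -
    have "\<not> x islimpt S" for x
    proof
      assume x: "x islimpt S"
      have "S \<subseteq> T" "S \<subseteq> C" using that e T by auto
      then have "x islimpt T" "x islimpt C" using x islimpt_subset by blast+
      then show False using T(3) assms(1) closed_limpt by blast
    qed
    then show ?thesis by (simp add: closed_limpt)
  qed
  have "continuous_on (range e) (\<lambda>x. real (inv e x))"
    unfolding continuous_on_closed_vimage[OF closed[OF order_refl]]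
    by (auto intro: closed)
  then have "continuous_map (subtopology euclidean (range e)) euclideanreal (\<lambda>x. real (inv e x))"
    by simp
  moreover have "normal_space (euclidean :: 'a topology)"
    by (simp add: metrizable_imp_normal_space metrizable_space_euclidean)
  moreover have "closedin euclidean (range e)"
    using closed by (simp add: closed_closedin[symmetric])
  ultimately obtain g where g: "continuous_map euclidean euclideanreal g"
      "\<And>x. x \<in> range e \<Longrightarrow> g x = real (inv e x)"
    using Tietze_extension_realinterval[of euclidean "range e" UNIV "\<lambda>x. real (inv e x)"]
    by (auto simp: is_interval_univ)
  have app: "apply_contfun (Contfun g) = g"
    using g(1) by (simp add: Contfun_inverse)
  have "ennreal (real n) \<le> sup_on C (Contfun g)" for n
  proof -
    have "g (e n) = real n" using g(2) e(1) by simp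
    moreover have "e n \<in> C" using e T by auto
    ultimately show ?thesis
      unfolding sup_on_def app by (intro SUP_upper2[of "e n"]) auto
  qed
  then have "sup_on C (Contfun g) = \<infinity>"
    by (metis ennreal_Ex_less_of_nat ennreal_of_nat_eq_real_of_nat infinity_ennreal_def leD
        less_top)
  then show ?thesis using that by blast
qed

lemma linear_separating_subspace:
  fixes V :: "'v::real_vector set"
  assumes "subspace V" "f \<notin> V"
  obtains F :: "'v \<Rightarrow> real" where "linear F" "\<And>v. v \<in> V \<Longrightarrow> F v = 0" "F f = 1"
proof -
  obtain E where E: "E \<subseteq> V" "independent E" "V \<subseteq> span E"
    by (rule maximal_independent_subset[of V])
  then have span: "span E = V"
    using assms(1) by (simp add: span_minimal subset_antisym)
  then have "independent (insert f E)"
    using E assms(2) by (simp add: independent_insert)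
  then obtain F :: "'v \<Rightarrow> real" where F: "linear F" "\<forall>x\<in>insert f E. F x = (if x = f then 1 else 0)"
    using linear_independent_extend[of "insert f E" "\<lambda>x. if x = f then 1 else 0"] by blast
  have "F v = 0" if "v \<in> V" for v
  proof (rule linear_eq_0_on_span[OF F(1)])
    show "v \<in> span E" using that span by simp
    show "F x = 0" if "x \<in> E" for x
      using that F(2) E(1) assms(2) by auto
  qed
  moreover have "F f = 1" using F(2) by simp
  ultimately show ?thesis using that F(1) by blast
qed

text \<open>A linear functional that annihilates the functions bounded on \<open>B\<close> is locally constant: it does
  not change under adding an \<open>h\<close> with \<open>sup_on B h < 1\<close>.\<close>

lemma bornology_dual_if_vanishes_on_bounded:
  assumes "bornology \<B>" "B \<in> \<B>" "linear F" and 0: "\<And>h. sup_on B h < \<infinity> \<Longrightarrow> F h = 0"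
  shows "F \<in> bornology_dual \<B>"
proof -
  have op: "openin (bornology_topology \<B>) {f. F f \<in> U}" for U
    unfolding openin_bornology_topology[OF assms(1)]
  proof (intro ballI bexI[of _ B] exI[of _ 1] conjI allI impI)
    fix f h assume f: "f \<in> {f. F f \<in> U}" and "sup_on B h < ennreal 1"
    then have "sup_on B h < \<infinity>" by (simp add: order_less_trans)
    then have "F h = 0" by (rule 0)
    then show "f + h \<in> {f. F f \<in> U}" using f linear_add[OF assms(3), of f h] by simp
  qed (use assms(2) in simp_all)
  have "topspace (bornology_topology \<B>) = UNIV"
    using openin_subset[OF op[of UNIV]] by auto
  then show ?thesis
    using op assms(3) by (simp add: bornology_dual_def continuous_map_def)
qed

section \<open>Definiteness and relative compactness\<close>

theorem proposition4p3:
  fixes \<B> :: "'a::metric_space set set"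
  assumes "bornology \<B>" and "has_closed_base \<B>"
  shows "defines_norm_on (bornology_dual \<B>) op_norm \<longleftrightarrow> \<B> \<subseteq> relatively_compact_sets"
proof
  assume compact: "\<B> \<subseteq> relatively_compact_sets"
  have "op_norm F = 0 \<longleftrightarrow> F = (\<lambda>_. 0)" if "F \<in> bornology_dual \<B>" for F
    using op_norm_definite[OF assms(1) compact that] op_norm_mult[of 0 F] by fastforce
  then show "defines_norm_on (bornology_dual \<B>) op_norm"
    using op_norm_finite[OF assms(1)]
    by (auto simp: defines_norm_on_def op_norm_mult op_norm_add_le)
next
  assume norm: "defines_norm_on (bornology_dual \<B>) op_norm"
  show "\<B> \<subseteq> relatively_compact_sets"
  proof
    fix B assume B: "B \<in> \<B>"
    obtain C where C: "C \<in> \<B>" "closed C" "B \<subseteq> C"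
      using assms(2) B unfolding has_closed_base_def by blast
    have "compact C"
    proof (rule ccontr)
      assume "\<not> compact C"
      then obtain f where f: "sup_on C f = \<infinity>"
        using unbounded_on_closed_noncompact C(2) by blast
      obtain F :: "'a contfun \<Rightarrow> real" where F: "linear F" "\<And>h. sup_on C h < \<infinity> \<Longrightarrow> F h = 0" "F f = 1"
        using linear_separating_subspace[OF subspace_finite_sup_on, of f C] f by auto
      have "F \<in> bornology_dual \<B>"
        using bornology_dual_if_vanishes_on_bounded[OF assms(1) C(1) F(1,2)] .
      moreover have "op_norm F = 0"
        unfolding op_norm_eq_0_iff[OF F(1)]
        using F(2) le_less_trans[OF sup_on_mono[of C UNIV]] by blast
      ultimately have "F = (\<lambda>_. 0)"
        using norm by (simp add: defines_norm_on_def)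
      then show False using F(3) by simp
    qed
    then have "compact (closure B)"
      using C closure_minimal[of B C] compact_Int_closed[of C "closure B"] by (simp add: Int_absorb1)
    moreover have "B \<noteq> {}" using B assms(1) by (auto simp: bornology_def)
    ultimately show "B \<in> relatively_compact_sets" by (simp add: relatively_compact_sets_def)
  qed
qed

end
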